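(* Let $0<q\le 1$ and $R_q>0$ be fixed, let $n,p$ be positive integers, $T>0$, and let $D\in\mathbb{R}^{p\times p}$ be an orthonormal matrix with first column $p^{-1/2}\mathbbm{1}_{p\times 1}$ and remaining columns $\bar D=[d_2,\dots,d_p]\in\mathbb{R}^{p\times (p-1)}$. Let $\tilde K\ge 1$ be an integer with $\tilde K=O\big(R_q(\tfrac{\log p}{T})^{-q/2}\big)$, i.e. $\tilde K\le C_K R_q(\tfrac{\log p}{T})^{-q/2}$ for a fixed constant $C_K>0$, and suppose $p\ge\max\big(260,\tfrac{33\tilde K}{2}+1\big)$. Let $a_\ell<a_u$ be constants, let $\tilde A\in[a_\ell/\sqrt n,a_u/\sqrt n]^{n\times p}$, and suppose that $$A=\frac{\tilde A+\frac{a_u-2a_\ell}{\sqrt n}\mathbbm{1}_{n\times p}}{2(a_u-a_\ell)\sqrt n},$$ and that there is $\delta_{\tilde K}\in(0,1)$ such that $\|\tilde A D u\|_2^2\le(1+\delta_{\tilde K})\|u\|_2^2$ for all $u\in\mathbb{R}^p$ with $\|u\|_0\le 2\tilde K$. Observe $y\sim\text{Poisson}(TAf^* )$ with $f^*\in\mathcal{F}_{p,q,D}$. Then there exists a constant $C_L>0$ depending on $a_u,a_\ell,\delta_{\tilde K}$ (with $q$ and the implicit constant $C_K$ regarded as fixed) such that, with probability greater than $\tfrac12$, $$\min_{f}\max_{f^*\in\mathcal{F}_{p,q,D}}\|f-f^*\|_2^2\ \ge\ C_L\max_{1\le k\le\tilde K}\left\{\min\left(\frac{k}{p^2\lambda_k^2},\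 \frac{k\log\frac pk}{T}\right)\right\},$$ where $\lambda_k=\lambda_k(\bar D)$ and the minimum is over estimators $f=f(A,y)$ that are measurable functions of $(A,y)$. Explicitly: for every measurable $f=f(A,y)$, $$\sup_{f^*\in\mathcal{F}_{p,q,D}}\mathbb{P}_{f^*}\left(\|f(A,y)-f^*\|_2^2\ge C_L\max_{1\le k\le\tilde K}\min\left(\frac{k}{p^2\lambda_k^2},\frac{k\log\frac pk}{T}\right)\right)>\frac12 .$$
   Context: $\mathbbm{1}_{a\times b}$ is the all-ones $a\times b$ matrix; $\|u\|_0$ is the number of nonzero entries of $u$; $\|u\|_q^q=\sum_j|u_j|^q$. $\mathcal{F}_{p,q,D}=\{f\in\mathbb{R}^p_+ : \|f\|_1=1,\ \|\bar D^\top f\|_q^q\le R_q\}$, where $\mathbb{R}^p_+$ is the set of vectors with nonnegative entries. $y\sim\text{Poisson}(\mu)$ for $\mu\in\mathbb{R}^n_+$ means $y_1,\dots,y_n$ are independent with $y_i\sim\text{Poisson}(\mu_i)$. The matrix $A$ and the intensity $T$ are known and deterministic; $\mathbb{P}_{f^*}$ denotes the law of $y\sim\text{Poisson}(TAf^* )$. $k$-sparse localization quantity: for a matrix $X$, $\lambda_k(X)=\max\{\|Xv\|_\infty : v \text{ has entries in }\{-1,0,1\},\ \|v\|_0=k\}$, with $v$ of length equal to the number of columns of $X$ (so $v\in\{-1,0,1\}^{p-1}$ for $X=\bar D$). *)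

theory Defs
  imports "HOL-Probability.Probability"
begin

text \<open>The dimensions are bound inside the statement, below the constant that must not depend on
  them, so vectors and matrices are extensional functions on initial segments of \<^typ>\<open>nat\<close>,
  indexed from 0. The space of the product measure \<open>vec_borel m\<close> is exactly \<open>rvec m\<close>,
  and that of \<open>mat_borel m n\<close> is exactly \<open>rmat m n\<close>.\<close>

definition rvec :: "nat \<Rightarrow> (nat \<Rightarrow> real) set"
  where "rvec m = {..<m} \<rightarrow>\<^sub>E UNIV"

definition rmat :: "nat \<Rightarrow> nat \<Rightarrow> (nat \<Rightarrow> nat \<Rightarrow> real) set"
  where "rmat m n = {..<m} \<rightarrow>\<^sub>E rvec n"

definition vec_borel :: "nat \<Rightarrow> (nat \<Rightarrow> real) measure"
  where "vec_borel m = (\<Pi>\<^sub>M i\<in>{..<m}. borel)"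

definition mat_borel :: "nat \<Rightarrow> nat \<Rightarrow> (nat \<Rightarrow> nat \<Rightarrow> real) measure"
  where "mat_borel m n = (\<Pi>\<^sub>M i\<in>{..<m}. vec_borel n)"

definition mat_vec :: "nat \<Rightarrow> nat \<Rightarrow> (nat \<Rightarrow> nat \<Rightarrow> real) \<Rightarrow> (nat \<Rightarrow> real) \<Rightarrow> nat \<Rightarrow> real"
  where "mat_vec m n X v = (\<lambda>i\<in>{..<m}. \<Sum>j<n. X i j * v j)"

definition mat_transpose :: "nat \<Rightarrow> nat \<Rightarrow> (nat \<Rightarrow> nat \<Rightarrow> real) \<Rightarrow> nat \<Rightarrow> nat \<Rightarrow> real"
  where "mat_transpose m n X = (\<lambda>j\<in>{..<n}. \<lambda>i\<in>{..<m}. X i j)"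

definition orthonormal_mat :: "nat \<Rightarrow> (nat \<Rightarrow> nat \<Rightarrow> real) \<Rightarrow> bool"
  where "orthonormal_mat p D \<longleftrightarrow> D \<in> rmat p p \<and>
    (\<forall>j<p. \<forall>k<p. (\<Sum>i<p. D i j * D i k) = (if j = k then 1 else 0))"

definition drop_first_col :: "nat \<Rightarrow> nat \<Rightarrow> (nat \<Rightarrow> nat \<Rightarrow> real) \<Rightarrow> nat \<Rightarrow> nat \<Rightarrow> real"
  where "drop_first_col m n X = (\<lambda>i\<in>{..<m}. \<lambda>j\<in>{..<n - 1}. X i (Suc j))"

definition norm0 :: "nat \<Rightarrow> (nat \<Rightarrow> real) \<Rightarrow> nat"
  where "norm0 m v = card {j. j < m \<and> v j \<noteq> 0}"

definition norm1 :: "nat \<Rightarrow> (nat \<Rightarrow> real) \<Rightarrow> real"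
  where "norm1 m v = (\<Sum>j<m. \<bar>v j\<bar>)"

definition norm2 :: "nat \<Rightarrow> (nat \<Rightarrow> real) \<Rightarrow> real"
  where "norm2 m v = sqrt (\<Sum>j<m. (v j)\<^sup>2)"

text \<open>The \<open>q\<close>-th power of the \<open>q\<close>-quasinorm; \<open>0 powr q = 0\<close>, so zero entries contribute nothing.\<close>

definition normq_pow :: "real \<Rightarrow> nat \<Rightarrow> (nat \<Rightarrow> real) \<Rightarrow> real"
  where "normq_pow q m v = (\<Sum>j<m. \<bar>v j\<bar> powr q)"

text \<open>\<^const>\<open>Max\<close> is over a nonempty set only if \<open>0 < m\<close>.\<close>

definition norm_inf :: "nat \<Rightarrow> (nat \<Rightarrow> real) \<Rightarrow> real"
  where "norm_inf m v = Max ((\<lambda>j. \<bar>v j\<bar>) ` {..<m})"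

text \<open>\<^const>\<open>Max\<close> is over a finite set, which is nonempty exactly when \<open>k \<le> n\<close>.\<close>

definition sparse_localization :: "nat \<Rightarrow> nat \<Rightarrow> (nat \<Rightarrow> nat \<Rightarrow> real) \<Rightarrow> nat \<Rightarrow> real"
  where "sparse_localization m n X k =
    Max {norm_inf m (mat_vec m n X v) | v. v \<in> {..<n} \<rightarrow>\<^sub>E {-1, 0, 1} \<and> norm0 n v = k}"

definition signal_class :: "nat \<Rightarrow> real \<Rightarrow> real \<Rightarrow> (nat \<Rightarrow> nat \<Rightarrow> real) \<Rightarrow> (nat \<Rightarrow> real) set"
  where "signal_class p q R D = {f \<in> rvec p. (\<forall>j<p. 0 \<le> f j) \<and> norm1 p f = 1 \<and>
    normq_pow q (p - 1) (mat_vec (p - 1) p (mat_transpose p (p - 1) (drop_first_col p p D)) f) \<le> R}"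

text \<open>\<^const>\<open>poisson_pmf\<close> is specified only for positive rates; rate 0 is the point mass at 0.\<close>

definition poisson0_pmf :: "real \<Rightarrow> nat pmf"
  where "poisson0_pmf \<mu> = (if \<mu> = 0 then return_pmf 0 else poisson_pmf \<mu>)"

definition poisson_law :: "nat \<Rightarrow> (nat \<Rightarrow> real) \<Rightarrow> (nat \<Rightarrow> nat) measure"
  where "poisson_law n \<mu> = (\<Pi>\<^sub>M i\<in>{..<n}. measure_pmf (poisson0_pmf (\<mu> i)))"

definition count_vec_space :: "nat \<Rightarrow> (nat \<Rightarrow> nat) measure"
  where "count_vec_space n = (\<Pi>\<^sub>M i\<in>{..<n}. count_space UNIV)"

definition estimators ::
    "nat \<Rightarrow> nat \<Rightarrow> ((nat \<Rightarrow> nat \<Rightarrow> real) \<times> (nat \<Rightarrow> nat) \<Rightarrow> nat \<Rightarrow> real) set"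
  where "estimators n p = (mat_borel n p \<Otimes>\<^sub>M count_vec_space n) \<rightarrow>\<^sub>M vec_borel p"

end

theory Submission
  imports Defs
begin

text \<open>Fix the \<open>k\<close> attaining the maximum, put \<open>m = (p - 1) div k\<close>, and let the hypotheses be the signals
  \<open>D (1 / sqrt p, \<alpha> 1\<^sub>S)\<close>, where \<open>S\<close> contains one index from each of \<open>k\<close> consecutive blocks of length
  \<open>m\<close>; there are \<open>m\<^sup>k\<close> of them. The localization quantity keeps them nonnegative for \<open>\<alpha> \<le> 1 / (p \<lambda>\<^sub>k)\<close>.
  Instead of a packing and Fano's inequality, all \<open>m\<^sup>k\<close> hypotheses are used at once: an
  estimate can be close only to hypotheses in a Hamming ball of radius \<open>k / 4\<close>, which has at most
  \<open>x\<^sup>2\<close> elements for \<open>x = m powr (k / 4)\<close>, while \<open>m\<^sup>k = x\<^sup>4\<close>. The entries of \<open>A\<close> are at least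
  \<open>1 / (2 n)\<close>, so by the upper restricted isometry bound the chi-square divergence of each hypothesis from the
  flat signal is at most \<open>x - 1\<close> for small \<open>\<alpha>\<close>. Changing measure to the flat signal, the average success
  probability is at most \<open>1 / 4 + x\<^sup>3 / x\<^sup>4\<close>, which is below \<open>1 / 2\<close> because \<open>x > 4\<close>.\<close>

section \<open>Change of measure for Poisson vectors\<close>

text \<open>This is one plus the chi-square divergence. Weighted by the mass of rate
  \<open>\<nu>\<close>, the squared ratio becomes the exponential series in
  \<open>\<mu>\<^sup>2 / \<nu>\<close> times \<open>exp (\<nu> - 2 * \<mu>)\<close>, and the
  exponents combine to a square over \<open>\<nu>\<close>.\<close>

lemma nn_integral_poisson_ratio_sq:
  assumes "0 < \<mu>" and "0 < \<nu>"
  shows "(\<integral>\<^sup>+y. ennreal ((pmf (poisson_pmf \<mu>) y / pmf (poisson_pmf \<nu>) y)\<^sup>2) \<partial>measure_pmf (poisson_pmf \<nu>))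
    = ennreal (exp ((\<mu> - \<nu>)\<^sup>2 / \<nu>))"
proof -
  let ?c = "exp (\<nu> - 2 * \<mu>)"
  have weight: "ennreal (pmf (poisson_pmf \<nu>) y) * ennreal ((pmf (poisson_pmf \<mu>) y / pmf (poisson_pmf \<nu>) y)\<^sup>2)
      = ennreal (?c * ((\<mu>\<^sup>2 / \<nu>) ^ y /\<^sub>R fact y))" for y
  proof -
    have "exp (\<nu> - 2 * \<mu>) = (exp (-\<mu>))\<^sup>2 / exp (-\<nu>)"
      by (simp add: exp_minus exp_diff exp_double [symmetric] field_simps)
    then show ?thesis
      using assms by (subst ennreal_mult [symmetric])
        (auto simp: power2_eq_square power_mult_distrib power_divide field_simps)
  qed
  have "(\<lambda>y. (\<mu>\<^sup>2 / \<nu>) ^ y /\<^sub>R fact y) sums exp (\<mu>\<^sup>2 / \<nu>)"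
    by (rule exp_converges)
  then have "(\<lambda>y. ?c * ((\<mu>\<^sup>2 / \<nu>) ^ y /\<^sub>R fact y)) sums (?c * exp (\<mu>\<^sup>2 / \<nu>))"
    by (rule sums_mult)
  moreover have "?c * exp (\<mu>\<^sup>2 / \<nu>) = exp ((\<mu> - \<nu>)\<^sup>2 / \<nu>)"
    using assms by (simp add: exp_add [symmetric] power2_eq_square field_simps)
  ultimately show ?thesis
    using assms unfolding nn_integral_measure_pmf weight nn_integral_count_space_nat
    by (subst suminf_ennreal2) (auto simp: sums_iff)
qed

lemma sets_poisson_law [simp]: "sets (poisson_law n \<mu>) = sets (count_vec_space n)"
  unfolding poisson_law_def count_vec_space_def by (intro sets_PiM_cong) auto

lemma space_poisson_law [simp]: "space (poisson_law n \<mu>) = space (count_vec_space n)"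
  by (rule sets_eq_imp_space_eq) simp

lemma prob_space_poisson_law: "prob_space (poisson_law n \<mu>)"
  unfolding poisson_law_def by (intro prob_space_PiM prob_space_measure_pmf)

text \<open>Positive rates make every coordinate a genuine Poisson law with full support, so the
  coordinate ratios are densities. A product measure is determined by its values on boxes, where the
  integral of a product of coordinate functions factorizes.\<close>

lemma poisson_law_density:
  fixes \<mu> \<nu> :: "nat \<Rightarrow> real"
  assumes "\<And>i. i < n \<Longrightarrow> 0 < \<mu> i" and "\<And>i. i < n \<Longrightarrow> 0 < \<nu> i"
  shows "poisson_law n \<mu> = density (poisson_law n \<nu>)
    (\<lambda>y. \<Prod>i<n. ennreal (pmf (poisson_pmf (\<mu> i)) (y i) / pmf (poisson_pmf (\<nu> i)) (y i)))"
    (is "_ = density _ ?L")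
proof -
  let ?P = "\<lambda>i. measure_pmf (poisson0_pmf (\<nu> i))"
  interpret product_sigma_finite ?P
    by standard
  interpret \<mu>: product_sigma_finite "\<lambda>i. measure_pmf (poisson0_pmf (\<mu> i))"
    by standard
  have meas: "?L \<in> borel_measurable (PiM {..<n} ?P)"
    by (intro borel_measurable_prod_ennreal measurable_compose [OF measurable_component_singleton]) auto
  have "density (PiM {..<n} ?P) ?L = PiM {..<n} (\<lambda>i. measure_pmf (poisson0_pmf (\<mu> i)))"
  proof (rule \<mu>.PiM_eqI)
    show "sets (density (PiM {..<n} ?P) ?L) = sets (PiM {..<n} (\<lambda>i. measure_pmf (poisson0_pmf (\<mu> i))))"
      using sets_poisson_law [of n] by (simp add: poisson_law_def)
  next
    fix E assume "\<And>i. i \<in> {..<n} \<Longrightarrow> E i \<in> sets (measure_pmf (poisson0_pmf (\<mu> i)))"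
    have E: "PiE {..<n} E \<in> sets (PiM {..<n} ?P)"
      by (intro sets_PiM_I_finite) auto
    have "emeasure (density (PiM {..<n} ?P) ?L) (PiE {..<n} E)
        = (\<integral>\<^sup>+y. ?L y * indicator (PiE {..<n} E) y \<partial>PiM {..<n} ?P)"
      by (rule emeasure_density [OF meas E])
    also have "\<dots> = (\<integral>\<^sup>+y. (\<Prod>i<n. ennreal (pmf (poisson_pmf (\<mu> i)) (y i) / pmf (poisson_pmf (\<nu> i)) (y i))
        * indicator (E i) (y i)) \<partial>PiM {..<n} ?P)"
    proof (rule nn_integral_cong)
      fix y assume "y \<in> space (PiM {..<n} ?P)"
      then have "indicator (PiE {..<n} E) y = (\<Prod>i<n. indicator (E i) (y i) :: ennreal)"
        by (auto simp: indicator_def space_PiM PiE_iff)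
      then show "?L y * indicator (PiE {..<n} E) y = (\<Prod>i<n. ennreal (pmf (poisson_pmf (\<mu> i)) (y i) / pmf (poisson_pmf (\<nu> i)) (y i))
        * indicator (E i) (y i))"
        by (simp add: prod.distrib)
    qed
    also have "\<dots> = (\<Prod>i<n. \<integral>\<^sup>+y. ennreal (pmf (poisson_pmf (\<mu> i)) y / pmf (poisson_pmf (\<nu> i)) y)
        * indicator (E i) y \<partial>?P i)"
      by (rule product_nn_integral_prod) auto
    also have "\<dots> = (\<Prod>i<n. emeasure (measure_pmf (poisson0_pmf (\<mu> i))) (E i))"
    proof (rule prod.cong [OF refl])
      fix i assume "i \<in> {..<n}"
      then have pos: "0 < \<mu> i" "0 < \<nu> i" using assms by auto
      \<comment> \<open>The reference mass is positive at every count, so it cancels against the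
        denominator of the ratio.\<close>
      have "(\<integral>\<^sup>+y. ennreal (pmf (poisson_pmf (\<mu> i)) y / pmf (poisson_pmf (\<nu> i)) y) * indicator (E i) y \<partial>?P i)
        = (\<integral>\<^sup>+y. ennreal (pmf (poisson_pmf (\<mu> i)) y) * indicator (E i) y \<partial>count_space UNIV)"
        unfolding nn_integral_measure_pmf
        using pos by (intro nn_integral_cong)
          (simp add: poisson0_pmf_def mult.assoc [symmetric] ennreal_mult' [symmetric])
      also have "\<dots> = emeasure (measure_pmf (poisson0_pmf (\<mu> i))) (E i)"
        using pos by (simp add: poisson0_pmf_def nn_integral_measure_pmf [symmetric] nn_integral_indicator
           del: pmf_poisson)
      finally show "(\<integral>\<^sup>+y. ennreal (pmf (poisson_pmf (\<mu> i)) y / pmf (poisson_pmf (\<nu> i)) y) * indicator (E i) y \<partial>?P i)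
        = emeasure (measure_pmf (poisson0_pmf (\<mu> i))) (E i)" .
    qed
    finally show "emeasure (density (PiM {..<n} ?P) ?L) (PiE {..<n} E)
      = (\<Prod>i\<in>{..<n}. emeasure (measure_pmf (poisson0_pmf (\<mu> i))) (E i))" by simp
  qed simp
  then show ?thesis
    by (simp add: poisson_law_def)
qed

text \<open>The left side is the integral over \<open>S\<close> of the likelihood ratio under
  \<open>\<nu>\<close>. Only the second moment of the ratio enters, and it factorizes over
  coordinates. The free parameter \<open>x\<close> balances divergence against the reference
  probability.\<close>

lemma measure_poisson_law_le:
  fixes \<mu> \<nu> :: "nat \<Rightarrow> real"
  assumes \<mu>: "\<And>i. i < n \<Longrightarrow> 0 < \<mu> i" and \<nu>: "\<And>i. i < n \<Longrightarrow> 0 < \<nu> i"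
    and S: "S \<in> sets (count_vec_space n)" and x: "0 < x"
  shows "measure (poisson_law n \<mu>) S
    \<le> exp (\<Sum>i<n. (\<mu> i - \<nu> i)\<^sup>2 / \<nu> i) / (4 * x) + x * measure (poisson_law n \<nu>) S"
proof -
  let ?P = "\<lambda>i. measure_pmf (poisson0_pmf (\<nu> i))"
  let ?r = "\<lambda>i y. pmf (poisson_pmf (\<mu> i)) y / pmf (poisson_pmf (\<nu> i)) y"
  let ?L = "\<lambda>y. \<Prod>i<n. ?r i (y i)"
  interpret product_sigma_finite ?P
    by standard
  interpret N: prob_space "poisson_law n \<nu>" by (rule prob_space_poisson_law)
  interpret M: prob_space "poisson_law n \<mu>" by (rule prob_space_poisson_law)
  have L0: "0 \<le> ?L y" for y by (intro prod_nonneg) auto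
  have prodL: "(\<Prod>i<n. ennreal (?r i (y i))) = ennreal (?L y)" for y
    by (rule prod_ennreal) auto
  have measL: "(\<lambda>y. ?L y) \<in> borel_measurable (poisson_law n \<nu>)"
    unfolding poisson_law_def
    by (intro borel_measurable_prod measurable_compose [OF measurable_component_singleton]) auto
  have S' [measurable]: "S \<in> sets (poisson_law n \<nu>)" using S by simp
  have "(\<integral>\<^sup>+y. ennreal ((?L y)\<^sup>2) \<partial>poisson_law n \<nu>) = (\<integral>\<^sup>+y. (\<Prod>i<n. ennreal ((?r i (y i))\<^sup>2)) \<partial>PiM {..<n} ?P)"
    unfolding poisson_law_def by (intro nn_integral_cong) (simp add: prod_ennreal prod_power_distrib)
  also have "\<dots> = (\<Prod>i<n. \<integral>\<^sup>+y. ennreal ((?r i y)\<^sup>2) \<partial>?P i)"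
    by (rule product_nn_integral_prod) auto
  also have "\<dots> = (\<Prod>i<n. ennreal (exp ((\<mu> i - \<nu> i)\<^sup>2 / \<nu> i)))"
  proof (rule prod.cong [OF refl])
    fix i assume "i \<in> {..<n}"
    then have "0 < \<mu> i" "0 < \<nu> i" using \<mu> \<nu> by auto
    then show "(\<integral>\<^sup>+y. ennreal ((?r i y)\<^sup>2) \<partial>?P i) = ennreal (exp ((\<mu> i - \<nu> i)\<^sup>2 / \<nu> i))"
      using nn_integral_poisson_ratio_sq [of "\<mu> i" "\<nu> i"] by (simp add: poisson0_pmf_def del: pmf_poisson)
  qed
  also have "\<dots> = ennreal (exp (\<Sum>i<n. (\<mu> i - \<nu> i)\<^sup>2 / \<nu> i))"
    by (simp add: prod_ennreal exp_sum)
  finally have sq: "(\<integral>\<^sup>+y. ennreal ((?L y)\<^sup>2) \<partial>poisson_law n \<nu>) = ennreal (exp (\<Sum>i<n. (\<mu> i - \<nu> i)\<^sup>2 / \<nu> i))" .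
  \<comment> \<open>The likelihood ratio is split by AM-GM rather than Cauchy-Schwarz, so that the bound is linear in the reference
      probability and can be summed over hypotheses.\<close>
  have amgm: "t \<le> t\<^sup>2 / (4 * x) + x" for t :: real
  proof -
    have "0 \<le> (t - 2 * x)\<^sup>2 / (4 * x)" using x by simp
    also have "\<dots> = t\<^sup>2 / (4 * x) + x - t" using x by (simp add: power2_eq_square field_simps)
    finally show ?thesis by simp
  qed
  have "ennreal (measure (poisson_law n \<mu>) S) = emeasure (poisson_law n \<mu>) S"
    by (simp add: M.emeasure_eq_measure)
  also have "\<dots> = emeasure (density (poisson_law n \<nu>) (\<lambda>y. ennreal (?L y))) S"
    using poisson_law_density [OF \<mu> \<nu>, of n] by (simp add: prodL del: pmf_poisson)
  also have "\<dots> = (\<integral>\<^sup>+y. ennreal (?L y) * indicator S y \<partial>poisson_law n \<nu>)"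
    using measL S by (intro emeasure_density) auto
  also have "\<dots> \<le> (\<integral>\<^sup>+y. ennreal (1 / (4 * x)) * ennreal ((?L y)\<^sup>2) + ennreal x * indicator S y \<partial>poisson_law n \<nu>)"
  proof (rule nn_integral_mono)
    fix y
    have "ennreal (?L y) \<le> ennreal ((?L y)\<^sup>2 / (4 * x) + x)"
      by (rule ennreal_leI) (rule amgm)
    also have "\<dots> = ennreal (1 / (4 * x)) * ennreal ((?L y)\<^sup>2) + ennreal x"
      using x by (simp add: ennreal_mult [symmetric] ennreal_plus del: pmf_poisson)
    finally show "ennreal (?L y) * indicator S y \<le> ennreal (1 / (4 * x)) * ennreal ((?L y)\<^sup>2) + ennreal x * indicator S y"
      by (auto simp: indicator_def simp del: pmf_poisson)
  qed
  also have "\<dots> = ennreal (1 / (4 * x)) * ennreal (exp (\<Sum>i<n. (\<mu> i - \<nu> i)\<^sup>2 / \<nu> i)) + ennreal x * emeasure (poisson_law n \<nu>) S"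
    using measL S' sq by (subst nn_integral_add)
      (simp_all add: nn_integral_cmult nn_integral_cmult_indicator del: pmf_poisson sets_poisson_law)
  also have "\<dots> = ennreal (exp (\<Sum>i<n. (\<mu> i - \<nu> i)\<^sup>2 / \<nu> i) / (4 * x) + x * measure (poisson_law n \<nu>) S)"
    using x by (simp add: N.emeasure_eq_measure ennreal_mult [symmetric] ennreal_plus)
  finally show ?thesis
    using x by (subst (asm) ennreal_le_iff) (auto intro!: add_nonneg_nonneg)
qed

section \<open>Testing many hypotheses against one reference law\<close>

lemma (in prob_space) sum_prob_le_overlap:
  assumes "finite W" and S: "\<And>w. w \<in> W \<Longrightarrow> S w \<in> events"
    and B: "\<And>y. y \<in> space M \<Longrightarrow> real (card {w \<in> W. y \<in> S w}) \<le> B"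
  shows "(\<Sum>w\<in>W. prob (S w)) \<le> B"
proof -
  have "(\<Sum>w\<in>W. prob (S w)) = (\<Sum>w\<in>W. expectation (indicator (S w)))"
    using S by (intro sum.cong) auto
  \<comment> \<open>The integrand is now the number of events that occur at \<open>y\<close>, which
    \<open>B\<close> bounds pointwise.\<close>
  also have "\<dots> = expectation (\<lambda>y. \<Sum>w\<in>W. indicator (S w) y)"
    using S by (intro Bochner_Integration.integral_sum [symmetric]) (auto simp: emeasure_eq_measure)
  also have "\<dots> \<le> expectation (\<lambda>_. B)"
  proof (rule integral_mono)
    show "integrable M (\<lambda>y. \<Sum>w\<in>W. indicator (S w) y :: real)"
      using S by (intro Bochner_Integration.integrable_sum) (auto simp: emeasure_eq_measure)
    fix y assume "y \<in> space M"
    then show "(\<Sum>w\<in>W. indicator (S w) y) \<le> B"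
      using B [of y] \<open>finite W\<close> by (simp add: indicator_def sum.If_cases Int_def)
  qed simp
  finally show ?thesis by (simp add: prob_space)
qed

text \<open>\<open>S w\<close> stands for the event that the estimate is close to hypothesis
  \<open>w\<close>. Under the single law \<open>\<nu>\<close> the probabilities of these events sum
  to at most \<open>B\<close>, and changing measure costs a factor \<open>x\<close> and an additive
  1/4 per hypothesis. If every event had probability at least 1/2 under its own hypothesis,
  averaging would contradict \<open>big\<close>.\<close>

lemma poisson_many_hypotheses:
  fixes \<mu> :: "'w \<Rightarrow> nat \<Rightarrow> real" and \<nu> :: "nat \<Rightarrow> real"
  assumes W: "finite W"
    and \<mu>: "\<And>w i. w \<in> W \<Longrightarrow> i < n \<Longrightarrow> 0 < \<mu> w i" and \<nu>: "\<And>i. i < n \<Longrightarrow> 0 < \<nu> i"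
    and x: "0 < x" and chi: "\<And>w. w \<in> W \<Longrightarrow> exp (\<Sum>i<n. (\<mu> w i - \<nu> i)\<^sup>2 / \<nu> i) \<le> x"
    and S: "\<And>w. w \<in> W \<Longrightarrow> S w \<in> sets (count_vec_space n)"
    and B: "\<And>y. y \<in> space (count_vec_space n) \<Longrightarrow> real (card {w \<in> W. y \<in> S w}) \<le> B"
    and big: "4 * x * B < card W"
  shows "\<exists>w\<in>W. measure (poisson_law n (\<mu> w)) (S w) < 1 / 2"
proof (rule ccontr)
  assume "\<not> ?thesis"
  then have ge: "w \<in> W \<Longrightarrow> 1 / 2 \<le> measure (poisson_law n (\<mu> w)) (S w)" for w by force
  interpret prob_space "poisson_law n \<nu>" by (rule prob_space_poisson_law)
  have "card W / 2 = (\<Sum>w\<in>W. 1 / 2 :: real)" by simp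
  also have "\<dots> \<le> (\<Sum>w\<in>W. 1 / 4 + x * prob (S w))"
  proof (rule sum_mono)
    fix w assume w: "w \<in> W"
    have "measure (poisson_law n (\<mu> w)) (S w)
        \<le> exp (\<Sum>i<n. (\<mu> w i - \<nu> i)\<^sup>2 / \<nu> i) / (4 * x) + x * prob (S w)"
      by (rule measure_poisson_law_le) (use \<mu> [OF w] \<nu> S [OF w] x in auto)
    \<comment> \<open>The same \<open>x\<close> bounds the second moment and serves as the AM-GM
      weight, which turns the divergence term into a constant.\<close>
    moreover have "exp (\<Sum>i<n. (\<mu> w i - \<nu> i)\<^sup>2 / \<nu> i) / (4 * x) \<le> 1 / 4"
      using chi [OF w] x by (simp add: field_simps)
    ultimately show "1 / 2 \<le> 1 / 4 + x * prob (S w)" using ge [OF w] by linarith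
  qed
  also have "\<dots> = card W / 4 + x * (\<Sum>w\<in>W. prob (S w))"
    by (simp add: sum.distrib sum_distrib_left)
  also have "\<dots> \<le> card W / 4 + x * B"
    using x W S B by (intro add_left_mono mult_left_mono sum_prob_le_overlap) auto
  finally show False using big by linarith
qed

section \<open>Words and Hamming balls\<close>

text \<open>Only the positions in \<open>S\<close> are free, with \<open>m\<close> letters
  each.\<close>

lemma card_agree_off:
  fixes k m :: nat
  assumes "S \<subseteq> {..<k}"
  shows "card {w \<in> {..<k} \<rightarrow>\<^sub>E {..<m}. \<forall>b\<in>{..<k} - S. w b = u b} \<le> m ^ card S"
proof -
  let ?E = "{..<k} \<rightarrow>\<^sub>E {..<m}" and ?F = "PiE {..<k} (\<lambda>b. if b \<in> S then {..<m} else {u b})"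
  have "{w \<in> ?E. \<forall>b\<in>{..<k} - S. w b = u b} \<subseteq> ?F"
    by (auto simp: PiE_iff extensional_def)
  then have "card {w \<in> ?E. \<forall>b\<in>{..<k} - S. w b = u b} \<le> card ?F"
    by (intro card_mono finite_PiE) auto
  also have "card ?F = (\<Prod>b<k. if b \<in> S then m else 1)"
    by (simp add: card_PiE if_distrib cong: if_cong)
  also have "\<dots> = m ^ card S"
    using assms by (simp add: prod.If_cases Int_absorb1)
  finally show ?thesis .
qed

lemma finite_word_filter: "finite {w \<in> {..<k} \<rightarrow>\<^sub>E {..<m}. P w}" for k m :: nat
  by (rule finite_subset [of _ "{..<k} \<rightarrow>\<^sub>E {..<m}"]) (auto intro: finite_PiE)

text \<open>The ball is covered by choosing the set of disagreement, in at most \<open>2 ^ k\<close>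
  ways, and then the letters on it. The crude factor \<open>2 ^ k\<close> is affordable because
  later \<open>m\<close> is at least 16, so that it is at most
  \<open>m powr (k / 4)\<close>.\<close>

lemma card_hamming_ball_le:
  fixes k m :: nat
  assumes m: "0 < m"
  shows "real (card {w \<in> {..<k} \<rightarrow>\<^sub>E {..<m}. 4 * card {b. b < k \<and> w b \<noteq> u b} \<le> k})
    \<le> 2 ^ k * real m powr (real k / 4)"
proof -
  let ?E = "{..<k} \<rightarrow>\<^sub>E {..<m}" and ?Q = "{S. S \<subseteq> {..<k} \<and> 4 * card S \<le> k}"
  have finQ: "finite ?Q"
    by (rule finite_subset [of _ "Pow {..<k}"]) auto
  have "{w \<in> ?E. 4 * card {b. b < k \<and> w b \<noteq> u b} \<le> k}
      \<subseteq> (\<Union>S\<in>?Q. {w \<in> ?E. \<forall>b\<in>{..<k} - S. w b = u b})"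
  proof
    fix w assume "w \<in> {w \<in> ?E. 4 * card {b. b < k \<and> w b \<noteq> u b} \<le> k}"
    then show "w \<in> (\<Union>S\<in>?Q. {w \<in> ?E. \<forall>b\<in>{..<k} - S. w b = u b})"
      by (intro UN_I [of "{b. b < k \<and> w b \<noteq> u b}"]) auto
  qed
  then have "card {w \<in> ?E. 4 * card {b. b < k \<and> w b \<noteq> u b} \<le> k}
      \<le> card (\<Union>S\<in>?Q. {w \<in> ?E. \<forall>b\<in>{..<k} - S. w b = u b})"
    using finQ finite_word_filter by (intro card_mono finite_UN_I)
  also have "\<dots> \<le> (\<Sum>S\<in>?Q. card {w \<in> ?E. \<forall>b\<in>{..<k} - S. w b = u b})"
    using finQ by (rule card_UN_le)
  also have "\<dots> \<le> (\<Sum>S\<in>?Q. m ^ card S)"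
    by (intro sum_mono card_agree_off) auto
  finally have "real (card {w \<in> ?E. 4 * card {b. b < k \<and> w b \<noteq> u b} \<le> k})
      \<le> real (\<Sum>S\<in>?Q. m ^ card S)"
    by (rule of_nat_mono)
  also have "\<dots> = (\<Sum>S\<in>?Q. real m powr real (card S))"
    using m by (simp add: powr_realpow)
  also have "\<dots> \<le> (\<Sum>S\<in>?Q. real m powr (real k / 4))"
    using m by (intro sum_mono powr_mono) auto
  also have "\<dots> \<le> (\<Sum>S\<in>Pow {..<k}. real m powr (real k / 4))"
    by (intro sum_mono2) auto
  also have "\<dots> = 2 ^ k * real m powr (real k / 4)"
    by (simp add: card_Pow)
  finally show ?thesis .
qed

section \<open>Words encoded as index sets\<close>

definition word_support :: "nat \<Rightarrow> nat \<Rightarrow> (nat \<Rightarrow> nat) \<Rightarrow> nat set"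
  where "word_support k m w = (\<lambda>b. b * m + w b) ` {..<k}"

lemma word_support_index:
  fixes b m w :: nat
  assumes "w < m"
  shows "(b * m + w) div m = b" and "(b * m + w) mod m = w"
  using assms by (auto simp: div_add1_eq)

lemma word_support_subset:
  assumes w: "w \<in> {..<k} \<rightarrow>\<^sub>E {..<m}"
  shows "word_support k m w \<subseteq> {..<k * m}"
proof
  fix j assume "j \<in> word_support k m w"
  then obtain b where b: "b < k" "j = b * m + w b" by (auto simp: word_support_def)
  have "j < Suc b * m" using w b by (auto simp: PiE_iff)
  also have "\<dots> \<le> k * m" using b by (intro mult_right_mono) auto
  finally show "j \<in> {..<k * m}" by simp
qed

lemma card_word_support:
  assumes w: "w \<in> {..<k} \<rightarrow>\<^sub>E {..<m}"
  shows "card (word_support k m w) = k"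
proof -
  have "inj_on (\<lambda>b. b * m + w b) {..<k}"
    by (rule inj_on_inverseI [where g = "\<lambda>j. j div m"])
      (use w in \<open>auto simp: PiE_iff word_support_index\<close>)
  then show ?thesis by (simp add: word_support_def card_image)
qed

text \<open>Each block where the words differ contributes the index chosen by \<open>w\<close>,
  which \<open>u\<close> does not choose: quotient and remainder modulo \<open>m\<close> recover
  block and letter, so no other block of \<open>u\<close> can produce it.\<close>

lemma hamming_le_card_word_support_diff:
  assumes w: "w \<in> {..<k} \<rightarrow>\<^sub>E {..<m}" and u: "u \<in> {..<k} \<rightarrow>\<^sub>E {..<m}"
  shows "card {b. b < k \<and> w b \<noteq> u b} \<le> card (word_support k m w - word_support k m u)"
proof (rule card_inj_on_le)
  show "inj_on (\<lambda>b. b * m + w b) {b. b < k \<and> w b \<noteq> u b}"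
    by (rule inj_on_inverseI [where g = "\<lambda>j. j div m"])
      (use w in \<open>auto simp: PiE_iff word_support_index\<close>)
  show "(\<lambda>b. b * m + w b) ` {b. b < k \<and> w b \<noteq> u b} \<subseteq> word_support k m w - word_support k m u"
  proof
    fix j assume "j \<in> (\<lambda>b. b * m + w b) ` {b. b < k \<and> w b \<noteq> u b}"
    then obtain b where b: "b < k" "w b \<noteq> u b" "j = b * m + w b" by auto
    have "j \<noteq> c * m + u c" if c: "c < k" for c
    proof
      assume j: "j = c * m + u c"
      have "w b < m" "u c < m" using w u b c by (auto simp: PiE_iff)
      then have "b * m + w b = c * m + u c" using b j by simp
      then have "b = c" "w b = u c"
        using word_support_index [of "w b" m b] word_support_index [of "u c" m c]
          \<open>w b < m\<close> \<open>u c < m\<close> by metis+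
      then show False using b by simp
    qed
    then show "j \<in> word_support k m w - word_support k m u"
      using b by (auto simp: word_support_def)
  qed
  show "finite (word_support k m w - word_support k m u)" by (simp add: word_support_def)
qed

text \<open>If \<open>g\<close> is close to two points of the family, these are close to each other,
  so by separation their words differ in fewer than a quarter of the positions. Hence all close
  words lie in the Hamming ball around any one of them.\<close>

lemma card_close_points_le:
  fixes F :: "(nat \<Rightarrow> nat) \<Rightarrow> nat \<Rightarrow> real" and g :: "nat \<Rightarrow> real"
  assumes m: "0 < m"
    and sep: "\<And>w u. w \<in> {..<k} \<rightarrow>\<^sub>E {..<m} \<Longrightarrow> u \<in> {..<k} \<rightarrow>\<^sub>E {..<m} \<Longrightarrow>
      \<beta> * real (card {b. b < k \<and> w b \<noteq> u b}) \<le> (\<Sum>j<p. (F w j - F u j)\<^sup>2)"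
    and \<beta>: "0 \<le> \<beta>"
  shows "real (card {w \<in> {..<k} \<rightarrow>\<^sub>E {..<m}. (norm2 p (\<lambda>j. g j - F w j))\<^sup>2 < \<beta> * real k / 16})
    \<le> 2 ^ k * real m powr (real k / 4)" (is "real (card ?C) \<le> _")
proof (cases "?C = {}")
  case True
  then show ?thesis unfolding True by simp
next
  case False
  have norm: "(norm2 p v)\<^sup>2 = (\<Sum>j<p. (v j)\<^sup>2)" for v
    by (simp add: norm2_def sum_nonneg)
  obtain u where u: "u \<in> ?C" using False by blast
  have "?C \<subseteq> {w \<in> {..<k} \<rightarrow>\<^sub>E {..<m}. 4 * card {b. b < k \<and> w b \<noteq> u b} \<le> k}"
  proof
    fix w assume w: "w \<in> ?C"
    have "\<beta> * real (card {b. b < k \<and> w b \<noteq> u b}) \<le> (\<Sum>j<p. (F w j - F u j)\<^sup>2)"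
      using sep w u by auto
    also have "\<dots> \<le> (\<Sum>j<p. 2 * (g j - F w j)\<^sup>2 + 2 * (g j - F u j)\<^sup>2)"
    proof (rule sum_mono)
      fix j
      \<comment> \<open>This square is the remaining term of the parallelogram identity.\<close>
      have "0 \<le> ((g j - F w j) + (g j - F u j))\<^sup>2" by simp
      then show "(F w j - F u j)\<^sup>2 \<le> 2 * (g j - F w j)\<^sup>2 + 2 * (g j - F u j)\<^sup>2"
        by (simp add: power2_eq_square algebra_simps)
    qed
    also have "\<dots> = 2 * (norm2 p (\<lambda>j. g j - F w j))\<^sup>2 + 2 * (norm2 p (\<lambda>j. g j - F u j))\<^sup>2"
      by (simp add: norm sum.distrib sum_distrib_left)
    \<comment> \<open>Four times a sixteenth is a quarter. The inequality is strict, which excludes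
      \<open>\<beta> = 0\<close> and justifies cancelling \<open>\<beta>\<close>.\<close>
    also have "\<dots> < \<beta> * (real k / 4)"
      using u w by auto
    finally have "real (card {b. b < k \<and> w b \<noteq> u b}) < real k / 4"
      using \<beta> by (rule mult_left_less_imp_less)
    then show "w \<in> {w \<in> {..<k} \<rightarrow>\<^sub>E {..<m}. 4 * card {b. b < k \<and> w b \<noteq> u b} \<le> k}"
      using w by auto
  qed
  then have "card ?C \<le> card {w \<in> {..<k} \<rightarrow>\<^sub>E {..<m}. 4 * card {b. b < k \<and> w b \<noteq> u b} \<le> k}"
    by (intro card_mono finite_word_filter)
  then show ?thesis
    using card_hamming_ball_le [OF m, of k u] by linarith
qed

section \<open>Sparse signals\<close>

lemma orthonormal_mat_transpose_cancel:
  assumes D: "orthonormal_mat p D" and j: "j < p"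
  shows "(\<Sum>i<p. D i j * (\<Sum>l<p. D i l * x l)) = x j"
proof -
  have "(\<Sum>i<p. D i j * (\<Sum>l<p. D i l * x l)) = (\<Sum>l<p. \<Sum>i<p. D i j * D i l * x l)"
    unfolding sum_distrib_left by (subst sum.swap) (simp add: mult.assoc)
  also have "\<dots> = (\<Sum>l<p. (if j = l then 1 else 0) * x l)"
    using D j by (intro sum.cong) (auto simp: orthonormal_mat_def sum_distrib_right [symmetric])
  also have "\<dots> = x j" using j by (simp add: if_distrib [of "\<lambda>t. t * _"] cong: if_cong)
  finally show ?thesis .
qed

lemma orthonormal_mat_parseval:
  assumes D: "orthonormal_mat p D"
  shows "(\<Sum>i<p. (\<Sum>j<p. D i j * x j)\<^sup>2) = (\<Sum>j<p. (x j)\<^sup>2)"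
proof -
  have "(\<Sum>i<p. (\<Sum>j<p. D i j * x j)\<^sup>2) = (\<Sum>i<p. \<Sum>j<p. x j * (D i j * (\<Sum>l<p. D i l * x l)))"
    by (simp add: power2_eq_square sum_distrib_right algebra_simps)
  also have "\<dots> = (\<Sum>j<p. x j * (\<Sum>i<p. D i j * (\<Sum>l<p. D i l * x l)))"
    unfolding sum_distrib_left by (rule sum.swap)
  also have "\<dots> = (\<Sum>j<p. (x j)\<^sup>2)"
    using D by (intro sum.cong refl) (simp add: orthonormal_mat_transpose_cancel power2_eq_square)
  finally show ?thesis .
qed

lemma sum_lessThan_shift:
  fixes g :: "nat \<Rightarrow> 'a :: comm_monoid_add"
  assumes "0 < p"
  shows "(\<Sum>j<p. g j) = g 0 + (\<Sum>j<p - 1. g (Suc j))"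
  using assms by (cases p) (simp_all only: sum.lessThan_Suc_shift diff_Suc_1 less_irrefl)

text \<open>Columns of \<open>D\<close> are counted from 0, so coordinate \<open>j\<close> of \<open>D\<close> with its first column dropped is
  coordinate \<open>Suc j\<close> of \<open>D\<close>.\<close>

definition sparse_signal :: "nat \<Rightarrow> (nat \<Rightarrow> nat \<Rightarrow> real) \<Rightarrow> real \<Rightarrow> nat set \<Rightarrow> nat \<Rightarrow> real"
  where "sparse_signal p D \<alpha> S =
    mat_vec p p D (\<lambda>j. if j = 0 then 1 / sqrt (real p) else \<alpha> * indicator S (j - 1))"

lemma sparse_signal_diff:
  assumes "0 < p" and "i < p"
  shows "sparse_signal p D \<alpha> S i - sparse_signal p D \<alpha> S' i
    = (\<Sum>j<p. D i j * (if j = 0 then 0 else \<alpha> * (indicator S (j - 1) - indicator S' (j - 1))))"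
  using assms by (simp add: sparse_signal_def mat_vec_def sum_subtractf [symmetric])
    (auto intro!: sum.cong simp: algebra_simps)

lemma sum_indicator_card:
  fixes d :: nat and c :: real
  assumes "S \<subseteq> {..<d}"
  shows "(\<Sum>j<d. c * indicator S j) = c * real (card S)"
proof -
  have "(\<Sum>j<d. c * indicator S j) = (\<Sum>j\<in>S. c)"
    using assms by (intro sum.mono_neutral_cong_right) auto
  then show ?thesis by simp
qed

text \<open>By Parseval the distance can be read off the coefficients, which differ by
  \<open>\<alpha>\<close> in absolute value on the symmetric difference; one half of it,
  \<open>S - S'\<close>, is kept.\<close>

lemma sparse_signal_separation:
  assumes D: "orthonormal_mat p D" and p: "0 < p" and S: "S \<subseteq> {..<p - 1}"
  shows "\<alpha>\<^sup>2 * real (card (S - S')) \<le> (\<Sum>i<p. (sparse_signal p D \<alpha> S i - sparse_signal p D \<alpha> S' i)\<^sup>2)"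
proof -
  let ?x = "\<lambda>j. if j = 0 then 0 else \<alpha> * (indicator S (j - 1) - indicator S' (j - 1))"
  have "\<alpha>\<^sup>2 * real (card (S - S')) = (\<Sum>j<p - 1. \<alpha>\<^sup>2 * indicator (S - S') j)"
    using S by (intro sum_indicator_card [symmetric]) auto
  also have "\<dots> \<le> (\<Sum>j<p - 1. (?x (Suc j))\<^sup>2)"
    by (intro sum_mono) (auto simp: indicator_def power_mult_distrib)
  also have "\<dots> = (\<Sum>j<p. (?x j)\<^sup>2)"
    by (subst sum_lessThan_shift [OF p]) simp
  also have "\<dots> = (\<Sum>i<p. (\<Sum>j<p. D i j * ?x j)\<^sup>2)"
    by (rule orthonormal_mat_parseval [OF D, symmetric])
  also have "\<dots> = (\<Sum>i<p. (sparse_signal p D \<alpha> S i - sparse_signal p D \<alpha> S' i)\<^sup>2)"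
    using p by (intro sum.cong refl) (simp add: sparse_signal_diff)
  finally show ?thesis .
qed

text \<open>Summation is \<open>sqrt p\<close> times the inner product with column 0, so by
  orthonormality only the coefficient \<open>1 / sqrt p\<close> of that column survives.\<close>

lemma sum_sparse_signal:
  assumes D: "orthonormal_mat p D" and D0: "\<And>i. i < p \<Longrightarrow> D i 0 = 1 / sqrt (real p)" and p: "0 < p"
  shows "(\<Sum>i<p. sparse_signal p D \<alpha> S i) = 1"
proof -
  let ?x = "\<lambda>j. if j = 0 then 1 / sqrt (real p) else \<alpha> * indicator S (j - 1)"
  have "(\<Sum>i<p. sparse_signal p D \<alpha> S i) = sqrt (real p) * (\<Sum>i<p. D i 0 * (\<Sum>j<p. D i j * ?x j))"
    using p D0 by (simp add: sparse_signal_def mat_vec_def sum_distrib_left)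
  also have "\<dots> = sqrt (real p) * ?x 0"
    by (subst orthonormal_mat_transpose_cancel [OF D p]) (rule refl)
  finally show ?thesis using p by simp
qed

text \<open>This exhibits the signal as a perturbation of the flat one: it shows what nonnegativity
  requires, and \<open>S = {}\<close> gives the constant \<open>1 / p\<close>.\<close>

lemma sparse_signal_eq:
  assumes D0: "\<And>i. i < p \<Longrightarrow> D i 0 = 1 / sqrt (real p)" and i: "i < p"
  shows "sparse_signal p D \<alpha> S i = 1 / real p + \<alpha> * (\<Sum>j<p - 1. D i (Suc j) * indicator S j)"
proof -
  have p: "0 < p" using i by simp
  have "sparse_signal p D \<alpha> S i = D i 0 * (1 / sqrt (real p)) + (\<Sum>j<p - 1. D i (Suc j) * (\<alpha> * indicator S j))"
    using i by (simp add: sparse_signal_def mat_vec_def sum_lessThan_shift [OF p])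
  also have "(\<Sum>j<p - 1. D i (Suc j) * (\<alpha> * indicator S j)) = \<alpha> * (\<Sum>j<p - 1. D i (Suc j) * indicator S j)"
    unfolding sum_distrib_left by (intro sum.cong refl) (rule mult.left_commute)
  finally show ?thesis using D0 [OF i] by simp
qed

text \<open>The indicator of \<open>S\<close> is one of the sign vectors in the maximum. Those
  vectors form a finite set, so \<open>Max\<close> really is an upper bound.\<close>

lemma sparse_localization_bound:
  assumes S: "S \<subseteq> {..<d}" and i: "i < p"
  shows "\<bar>\<Sum>j<d. X i j * indicator S j\<bar> \<le> sparse_localization p d X (card S)"
proof -
  let ?V = "{v \<in> {..<d} \<rightarrow>\<^sub>E {-1, 0, 1 :: real}. norm0 d v = card S}"
  let ?v = "\<lambda>j\<in>{..<d}. indicator S j :: real"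
  have "{j. j < d \<and> ?v j \<noteq> 0} = S"
    using S by (auto simp: indicator_def)
  then have v: "?v \<in> ?V"
    by (auto simp: norm0_def indicator_def)
  have "finite ?V"
    by (rule finite_subset [of _ "{..<d} \<rightarrow>\<^sub>E {-1, 0, 1}"]) (auto intro: finite_PiE)
  then have fin: "finite ((\<lambda>v. norm_inf p (mat_vec p d X v)) ` ?V)" by simp
  have "\<bar>\<Sum>j<d. X i j * indicator S j\<bar> = \<bar>mat_vec p d X ?v i\<bar>"
    using i by (simp add: mat_vec_def)
  also have "\<dots> \<le> norm_inf p (mat_vec p d X ?v)"
    unfolding norm_inf_def using i by (intro Max_ge) auto
  also have "\<dots> \<le> Max ((\<lambda>v. norm_inf p (mat_vec p d X v)) ` ?V)"
    using fin v by (intro Max_ge) auto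
  also have "(\<lambda>v. norm_inf p (mat_vec p d X v)) ` ?V
      = {norm_inf p (mat_vec p d X v) | v. v \<in> {..<d} \<rightarrow>\<^sub>E {-1, 0, 1} \<and> norm0 d v = card S}"
    by auto
  finally show ?thesis by (simp add: sparse_localization_def)
qed

text \<open>\<open>loc\<close> keeps the perturbation below the flat level \<open>1 / p\<close>, so
  the signal is nonnegative and its 1-norm is its sum. The transpose recovers the coefficients,
  \<open>\<alpha>\<close> on \<open>S\<close> and 0 elsewhere, so that \<open>R\<close> is exactly
  the quasinorm constraint.\<close>

lemma sparse_signal_in_class:
  assumes D: "orthonormal_mat p D" and D0: "\<And>i. i < p \<Longrightarrow> D i 0 = 1 / sqrt (real p)" and p: "0 < p"
    and S: "S \<subseteq> {..<p - 1}" and \<alpha>: "0 \<le> \<alpha>"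
    and loc: "\<alpha> * sparse_localization p (p - 1) (drop_first_col p p D) (card S) \<le> 1 / real p"
    and R: "real (card S) * \<alpha> powr q \<le> R"
  shows "sparse_signal p D \<alpha> S \<in> signal_class p q R D"
proof -
  let ?f = "sparse_signal p D \<alpha> S"
  have nonneg: "0 \<le> ?f i" if i: "i < p" for i
  proof -
    have "\<bar>\<Sum>j<p - 1. D i (Suc j) * indicator S j\<bar>
        \<le> sparse_localization p (p - 1) (drop_first_col p p D) (card S)"
      using sparse_localization_bound [OF S i, of "drop_first_col p p D"] i
      by (simp add: drop_first_col_def)
    then have "\<alpha> * - (\<Sum>j<p - 1. D i (Suc j) * indicator S j) \<le> 1 / real p"
      using loc \<alpha> by (smt (verit) mult_left_mono)
    then show ?thesis
      using sparse_signal_eq [of p D i \<alpha> S, OF D0 i] by simp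
  qed
  have "norm1 p ?f = 1"
    using nonneg sum_sparse_signal [OF D D0 p, of \<alpha> S] by (simp add: norm1_def)
  moreover have "mat_vec (p - 1) p (mat_transpose p (p - 1) (drop_first_col p p D)) ?f j = \<alpha> * indicator S j"
    if j: "j < p - 1" for j
  proof -
    have "mat_vec (p - 1) p (mat_transpose p (p - 1) (drop_first_col p p D)) ?f j = (\<Sum>i<p. D i (Suc j) * ?f i)"
      using j by (simp add: mat_vec_def mat_transpose_def drop_first_col_def)
    also have "\<dots> = (\<Sum>i<p. D i (Suc j) * (\<Sum>l<p. D i l * (if l = 0 then 1 / sqrt (real p) else \<alpha> * indicator S (l - 1))))"
      by (simp add: sparse_signal_def mat_vec_def)
    also have "\<dots> = \<alpha> * indicator S j"
      using j by (subst orthonormal_mat_transpose_cancel [OF D]) auto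
    finally show ?thesis .
  qed
  \<comment> \<open>Off \<open>S\<close> the summand vanishes because
    \<open>0 powr q = 0\<close>.\<close>
  then have "normq_pow q (p - 1) (mat_vec (p - 1) p (mat_transpose p (p - 1) (drop_first_col p p D)) ?f)
      = (\<Sum>j<p - 1. \<alpha> powr q * indicator S j)"
    unfolding normq_pow_def using \<alpha> by (intro sum.cong refl) (auto simp: indicator_def)
  then have "normq_pow q (p - 1) (mat_vec (p - 1) p (mat_transpose p (p - 1) (drop_first_col p p D)) ?f) \<le> R"
    using R unfolding sum_indicator_card [OF S] by (simp only: mult.commute)
  moreover have "?f \<in> rvec p"
    by (auto simp: sparse_signal_def mat_vec_def rvec_def)
  ultimately show ?thesis
    using nonneg by (simp add: signal_class_def)
qed

section \<open>Divergence from the flat signal\<close>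

lemma mat_vec_simplex_ge:
  assumes A: "\<And>i j. i < n \<Longrightarrow> j < p \<Longrightarrow> c \<le> A i j" and i: "i < n"
    and f: "\<And>j. j < p \<Longrightarrow> 0 \<le> f j" "(\<Sum>j<p. f j) = 1"
  shows "c \<le> mat_vec n p A f i"
proof -
  have "c = (\<Sum>j<p. c * f j)" using f by (simp add: sum_distrib_left [symmetric])
  also have "\<dots> \<le> mat_vec n p A f i"
    using i A f by (auto simp: mat_vec_def intro!: sum_mono mult_right_mono)
  finally show ?thesis .
qed

text \<open>Both signals have mass 1, so the constant shift in \<open>A\<close> cancels in the
  difference and only a rescaled \<open>At\<close> acts on it, to which the isometry bound applies.
  Each denominator is at least \<open>T / (2 * n)\<close>, which offsets the factor
  \<open>1 / n\<close> from the squared scaling.\<close>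

lemma sparse_signal_chi_square_le:
  assumes D: "orthonormal_mat p D" and D0: "\<And>i. i < p \<Longrightarrow> D i 0 = 1 / sqrt (real p)" and p: "0 < p"
    and n: "0 < n" and T: "0 < T" and a: "a_l < a_u"
    and S: "S \<subseteq> {..<p - 1}"
    and A: "\<And>i j. i < n \<Longrightarrow> j < p \<Longrightarrow>
       A i j = (At i j + (a_u - 2 * a_l) / sqrt (real n)) / (2 * (a_u - a_l) * sqrt (real n))"
    and A_ge: "\<And>i j. i < n \<Longrightarrow> j < p \<Longrightarrow> 1 / (2 * real n) \<le> A i j"
    and rip: "\<And>u. u \<in> rvec p \<Longrightarrow> norm0 p u \<le> 2 * card S \<Longrightarrow>
       (norm2 n (mat_vec n p At (mat_vec p p D u)))\<^sup>2 \<le> (1 + \<delta>) * (norm2 p u)\<^sup>2"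
  shows "(\<Sum>i<n. (T * mat_vec n p A (sparse_signal p D \<alpha> S) i - T * mat_vec n p A (sparse_signal p D \<alpha> {}) i)\<^sup>2
       / (T * mat_vec n p A (sparse_signal p D \<alpha> {}) i))
    \<le> T * (1 + \<delta>) * \<alpha>\<^sup>2 * real (card S) / (2 * (a_u - a_l)\<^sup>2)"
proof -
  let ?f = "sparse_signal p D \<alpha> S" and ?g = "sparse_signal p D \<alpha> {}"
  \<comment> \<open>The coefficients of the difference: the common coefficient at 0 cancels, and the
    remaining support is \<open>S\<close> shifted by one.\<close>
  let ?u = "\<lambda>j\<in>{..<p}. if j = 0 then 0 else \<alpha> * indicator S (j - 1)"
  let ?z = "mat_vec n p At (mat_vec p p D ?u)"
  have Du: "mat_vec p p D ?u j = ?f j - ?g j" if j: "j < p" for j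
  proof -
    have "mat_vec p p D ?u j
        = (\<Sum>l<p. D j l * (if l = 0 then 0 else \<alpha> * (indicator S (l - 1) - indicator {} (l - 1))))"
      unfolding mat_vec_def restrict_apply using j by (auto intro!: sum.cong)
    also have "\<dots> = ?f j - ?g j"
      by (rule sparse_signal_diff [OF p j, symmetric])
    finally show ?thesis .
  qed
  have diff: "mat_vec n p A ?f i - mat_vec n p A ?g i = ?z i / (2 * (a_u - a_l) * sqrt (real n))"
    if i: "i < n" for i
  proof -
    let ?c = "2 * (a_u - a_l) * sqrt (real n)" and ?e = "(a_u - 2 * a_l) / sqrt (real n)"
    have "mat_vec n p A ?f i - mat_vec n p A ?g i = (\<Sum>j<p. A i j * (?f j - ?g j))"
      using i by (simp add: mat_vec_def sum_subtractf algebra_simps)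
    also have "\<dots> = (\<Sum>j<p. At i j * (?f j - ?g j) / ?c + ?e / ?c * (?f j - ?g j))"
      using i by (intro sum.cong refl) (simp add: A add_divide_distrib distrib_right)
    also have "\<dots> = (\<Sum>j<p. At i j * (?f j - ?g j)) / ?c + ?e / ?c * (\<Sum>j<p. ?f j - ?g j)"
      by (simp only: sum.distrib sum_divide_distrib sum_distrib_left)
    \<comment> \<open>Equal mass removes the contribution of the constant shift.\<close>
    also have "(\<Sum>j<p. ?f j - ?g j) = 0"
      using sum_sparse_signal [OF D D0 p] by (simp add: sum_subtractf)
    also have "(\<Sum>j<p. At i j * (?f j - ?g j)) = ?z i"
      using i Du by (simp add: mat_vec_def [of n])
    finally show ?thesis by simp
  qed
  have f0: "?g j = 1 / real p" if "j < p" for j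
    using sparse_signal_eq [of p D j \<alpha> "{}", OF D0 that] by simp
  have Af0: "1 / (2 * real n) \<le> mat_vec n p A ?g i" if i: "i < n" for i
    by (rule mat_vec_simplex_ge [OF A_ge i]) (use p f0 sum_sparse_signal [OF D D0 p] in auto)
  have "norm0 p ?u \<le> 2 * card S"
  proof -
    have "{j. j < p \<and> ?u j \<noteq> 0} \<subseteq> Suc ` S"
    proof
      fix j assume "j \<in> {j. j < p \<and> ?u j \<noteq> 0}"
      then have "j \<noteq> 0" "j - 1 \<in> S" by (auto simp: indicator_def split: if_splits)
      then show "j \<in> Suc ` S" by (intro image_eqI [of _ _ "j - 1"]) auto
    qed
    moreover have "finite S" using S finite_subset by blast
    ultimately have "norm0 p ?u \<le> card (Suc ` S)"
      unfolding norm0_def by (intro card_mono) auto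
    then show ?thesis by (simp add: card_image)
  qed
  then have "(norm2 n ?z)\<^sup>2 \<le> (1 + \<delta>) * (norm2 p ?u)\<^sup>2"
    by (intro rip) (auto simp: rvec_def)
  moreover have "(norm2 p ?u)\<^sup>2 = \<alpha>\<^sup>2 * real (card S)"
  proof -
    have "(norm2 p ?u)\<^sup>2 = (\<Sum>j<p. (?u j)\<^sup>2)" by (simp add: norm2_def sum_nonneg)
    also have "\<dots> = (\<Sum>j<p - 1. \<alpha>\<^sup>2 * indicator S j)"
    proof -
      have "(\<Sum>j<p - 1. (?u (Suc j))\<^sup>2) = (\<Sum>j<p - 1. \<alpha>\<^sup>2 * indicator S j)"
        by (intro sum.cong refl) (auto simp: indicator_def)
      moreover have "(?u 0)\<^sup>2 = 0" using p by simp
      ultimately show ?thesis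
        unfolding sum_lessThan_shift [OF p] by (simp only: add_0_left)
    qed
    finally show ?thesis by (simp only: sum_indicator_card [OF S])
  qed
  ultimately have z: "(\<Sum>i<n. (?z i)\<^sup>2) \<le> (1 + \<delta>) * (\<alpha>\<^sup>2 * real (card S))"
    by (simp add: norm2_def sum_nonneg)
  have arith: "(T * (z / (2 * e * sqrt N)))\<^sup>2 / (T * (1 / (2 * N))) = T / (2 * e\<^sup>2) * z\<^sup>2"
    if "0 < T" "0 < e" "0 < N" for T z e N :: real
    using that by (simp add: power_mult_distrib power_divide) (simp add: power2_eq_square field_simps)
  have "(\<Sum>i<n. (T * mat_vec n p A ?f i - T * mat_vec n p A ?g i)\<^sup>2 / (T * mat_vec n p A ?g i))
    \<le> (\<Sum>i<n. T / (2 * (a_u - a_l)\<^sup>2) * (?z i)\<^sup>2)"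
  proof (rule sum_mono)
    fix i assume "i \<in> {..<n}"
    then have i: "i < n" by simp
    have pos: "0 < T * (1 / (2 * real n))" using T n by simp
    have le: "T * (1 / (2 * real n)) \<le> T * mat_vec n p A ?g i"
      using T Af0 [OF i] by (intro mult_left_mono) auto
    have "(T * mat_vec n p A ?f i - T * mat_vec n p A ?g i)\<^sup>2 / (T * mat_vec n p A ?g i)
        \<le> (T * mat_vec n p A ?f i - T * mat_vec n p A ?g i)\<^sup>2 / (T * (1 / (2 * real n)))"
      by (rule divide_left_mono [OF le zero_le_power2 mult_pos_pos [OF less_le_trans [OF pos le] pos]])
    also have "\<dots> = T / (2 * (a_u - a_l)\<^sup>2) * (?z i)\<^sup>2"
      unfolding right_diff_distrib [symmetric] diff [OF i]
      by (rule arith) (use n a T in auto)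
    finally show "(T * mat_vec n p A ?f i - T * mat_vec n p A ?g i)\<^sup>2 / (T * mat_vec n p A ?g i)
      \<le> T / (2 * (a_u - a_l)\<^sup>2) * (?z i)\<^sup>2" .
  qed
  also have "\<dots> = T / (2 * (a_u - a_l)\<^sup>2) * (\<Sum>i<n. (?z i)\<^sup>2)"
    by (simp add: sum_distrib_left)
  also have "\<dots> \<le> T / (2 * (a_u - a_l)\<^sup>2) * ((1 + \<delta>) * (\<alpha>\<^sup>2 * real (card S)))"
    using T a by (intro mult_left_mono z) auto
  finally show ?thesis by (simp add: mult_ac)
qed

section \<open>The lower bound\<close>

text \<open>With \<open>x = m powr (k / 4)\<close>, the first bound will give
  \<open>2 ^ k \<le> x\<close>, the second \<open>4 < x\<close>, and the third converts the rate
  \<open>ln (p / k)\<close> into the block entropy \<open>ln m\<close>.\<close>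

lemma block_length_bounds:
  fixes k p :: nat
  assumes k: "1 \<le> k" and p: "260 \<le> p" and kp: "33 * real k / 2 + 1 \<le> real p"
  shows "16 \<le> (p - 1) div k" and "256 < ((p - 1) div k) ^ k"
    and "ln (real p / real k) / 2 \<le> ln (real ((p - 1) div k))"
proof -
  let ?m = "(p - 1) div k"
  have "16 * k \<le> p - 1" using kp by linarith
  then show m: "16 \<le> ?m" using k by (simp add: less_eq_div_iff_mult_less_eq)
  \<comment> \<open>For \<open>k = 1\<close> the block length is \<open>p - 1\<close>, at least 259;
    for \<open>k = 2\<close> the same bound on \<open>p\<close> gives \<open>m \<ge> 17\<close>;
    from \<open>k = 3\<close> on, \<open>16 ^ 3\<close> is enough.\<close>
  consider "k = 1" | "k = 2" | "3 \<le> k" using k by linarith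
  then show "256 < ?m ^ k"
  proof cases
    case 1
    then show ?thesis using p by simp
  next
    case 2
    have "17 \<le> ?m" using p 2 by simp
    then have "17 ^ 2 \<le> ?m ^ 2" by (rule power_mono) simp
    then show ?thesis using 2 by simp
  next
    case 3
    have "(16::nat) ^ 3 \<le> 16 ^ k" using 3 by (intro power_increasing) auto
    also have "\<dots> \<le> ?m ^ k" using m by (intro power_mono) auto
    finally show ?thesis by simp
  qed
  \<comment> \<open>Strictness makes up for the lost unit: \<open>p\<close> itself is at most
    \<open>(m + 1) * k\<close>, and \<open>m + 1\<close> is at most
    \<open>m\<^sup>2\<close>.\<close>
  have "p - 1 < Suc ?m * k"
    using k dividend_less_div_times [of k "p - 1"] by simp
  then have "p \<le> Suc ?m * k" using p by linarith
  then have "real p \<le> real (Suc ?m) * real k"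
    by (metis of_nat_le_iff of_nat_mult)
  then have "real p / real k \<le> real (Suc ?m)" using k by (simp add: field_simps)
  also have "\<dots> \<le> (real ?m)\<^sup>2"
  proof -
    have "Suc ?m \<le> 2 * ?m" using m by linarith
    also have "\<dots> \<le> ?m * ?m" using m by (intro mult_right_mono) auto
    finally show ?thesis by (metis of_nat_le_iff of_nat_mult power2_eq_square)
  qed
  finally have "ln (real p / real k) \<le> ln ((real ?m)\<^sup>2)"
    using k p m by (subst ln_le_cancel_iff) auto
  also have "\<dots> = 2 * ln (real ?m)" using m by (simp add: ln_realpow)
  finally show "ln (real p / real k) / 2 \<le> ln (real ?m)" by simp
qed

text \<open>A section of a jointly measurable map is measurable at points of the space, which is why
  \<open>A\<close> must be an extensional matrix.\<close>

lemma estimator_event_measurable: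
  assumes f: "f \<in> estimators n p" and A: "A \<in> rmat n p"
  shows "(\<lambda>y. (norm2 p (\<lambda>j. f (A, y) j - g j))\<^sup>2) \<in> borel_measurable (count_vec_space n)"
proof -
  have "A \<in> space (mat_borel n p)"
    using A by (simp add: mat_borel_def vec_borel_def rmat_def rvec_def space_PiM)
  then have "(\<lambda>y. f (A, y)) \<in> count_vec_space n \<rightarrow>\<^sub>M vec_borel p"
    using f unfolding estimators_def by (intro measurable_compose [OF measurable_Pair1']) auto
  then have "(\<lambda>y. f (A, y) j) \<in> borel_measurable (count_vec_space n)" if "j < p" for j
    using that unfolding vec_borel_def by (auto intro: measurable_compose [OF _ measurable_component_singleton])
  then have "(\<lambda>y. sqrt (\<Sum>j<p. (f (A, y) j - g j)\<^sup>2) ^ 2) \<in> borel_measurable (count_vec_space n)"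
    by (intro borel_measurable_power borel_measurable_sum borel_measurable_diff
        measurable_compose [OF _ borel_measurable_sqrt]) auto
  then show ?thesis by (simp add: norm2_def)
qed

text \<open>The bound for one sparsity level and amplitude. The amplitude obeys three constraints:
  \<open>loc\<close> for nonnegativity, \<open>R\<close> for the class, and \<open>info\<close> for
  indistinguishability from the flat signal.\<close>

lemma sparse_minimax_lower_bound:
  fixes a_l a_u \<delta> \<alpha> T q R :: real and n p k :: nat and D At A :: "nat \<Rightarrow> nat \<Rightarrow> real"
  assumes D: "orthonormal_mat p D" and D0: "\<And>i. i < p \<Longrightarrow> D i 0 = 1 / sqrt (real p)"
    and n: "0 < n" and T: "0 < T" and a: "a_l < a_u"
    and k: "1 \<le> k" and p: "260 \<le> p" and kp: "33 * real k / 2 + 1 \<le> real p"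
    and A: "A \<in> rmat n p" and A_eq: "\<And>i j. i < n \<Longrightarrow> j < p \<Longrightarrow>
       A i j = (At i j + (a_u - 2 * a_l) / sqrt (real n)) / (2 * (a_u - a_l) * sqrt (real n))"
    and At_ge: "\<And>i j. i < n \<Longrightarrow> j < p \<Longrightarrow> a_l / sqrt (real n) \<le> At i j"
    and rip: "\<And>u. u \<in> rvec p \<Longrightarrow> norm0 p u \<le> 2 * k \<Longrightarrow>
       (norm2 n (mat_vec n p At (mat_vec p p D u)))\<^sup>2 \<le> (1 + \<delta>) * (norm2 p u)\<^sup>2"
    and \<delta>: "0 < \<delta>" and \<alpha>: "0 \<le> \<alpha>"
    and loc: "\<alpha> * sparse_localization p (p - 1) (drop_first_col p p D) k \<le> 1 / real p"
    and R: "real k * \<alpha> powr q \<le> R"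
    and info: "\<alpha>\<^sup>2 \<le> (a_u - a_l)\<^sup>2 / (4 * (1 + \<delta>)) * (ln (real p / real k) / T)"
    and f: "f \<in> estimators n p"
  shows "\<exists>fs\<in>signal_class p q R D. 1 / 2 < measure (poisson_law n (\<lambda>i. T * mat_vec n p A fs i))
    {y \<in> space (count_vec_space n). \<alpha>\<^sup>2 * real k / 16 \<le> (norm2 p (\<lambda>j. f (A, y) j - fs j))\<^sup>2}"
proof -
  define m where "m = (p - 1) div k"
  define W where "W = {..<k} \<rightarrow>\<^sub>E {..<m}"
  define F where "F = (\<lambda>w. sparse_signal p D \<alpha> (word_support k m w))"
  define g where "g = sparse_signal p D \<alpha> {}"
  \<comment> \<open>All counts are expressed through \<open>x\<close>: there are
    \<open>x ^ 4\<close> words, at most \<open>x * x\<close> are close to any estimate, and the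
    second moments of the likelihood ratios are at most \<open>x\<close>.\<close>
  define x where "x = real m powr (real k / 4)"
  \<comment> \<open>\<open>E w\<close> is the complement of the event in the claim.\<close>
  define E where "E = (\<lambda>w. {y \<in> space (count_vec_space n).
    (norm2 p (\<lambda>j. f (A, y) j - F w j))\<^sup>2 < \<alpha>\<^sup>2 * real k / 16})"
  have p0: "0 < p" using p by simp
  note m = block_length_bounds [OF k p kp, folded m_def]
  have mpos: "0 < m" using m by simp
  have finW: "finite W" by (simp add: W_def finite_PiE)
  have cardW: "real (card W) = x ^ 4"
  proof -
    have "x ^ 4 = real m powr real k"
      unfolding x_def using mpos by (subst powr_power) auto
    also have "\<dots> = real m ^ k" using mpos by (simp add: powr_realpow)
    finally show ?thesis by (simp add: W_def card_PiE)
  qed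
  have x4: "4 < x"
  proof -
    have "(4::real) ^ 4 < x ^ 4"
      using m(2) by (simp add: cardW [symmetric] W_def card_PiE) (metis of_nat_less_iff of_nat_numeral of_nat_power)
    then show ?thesis by (rule power_less_imp_less_base) (simp add: x_def)
  qed
  \<comment> \<open>\<open>2 ^ k\<close> is \<open>16 powr (k / 4)\<close>, and the block length is
    at least 16.\<close>
  have two_le: "2 ^ k \<le> x"
  proof -
    have "(2::real) ^ k = 16 powr (real k / 4)"
    proof -
      have "(16::real) powr (real k / 4) = (2 powr 4) powr (real k / 4)" by simp
      also have "\<dots> = 2 ^ k" by (simp only: powr_powr) (simp add: powr_realpow)
      finally show ?thesis by simp
    qed
    also have "\<dots> \<le> x" unfolding x_def using m(1) by (intro powr_mono2) auto
    finally show ?thesis .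
  qed
  have km: "k * m \<le> p - 1" by (simp add: m_def)
  have supp: "word_support k m w \<subseteq> {..<p - 1}" "card (word_support k m w) = k" if "w \<in> W" for w
    using word_support_subset [of w k m] card_word_support [of w k m] km that by (auto simp: W_def)
  have cls: "F w \<in> signal_class p q R D" if w: "w \<in> W" for w
    unfolding F_def by (rule sparse_signal_in_class [OF D D0 p0 supp(1) [OF w] \<alpha>])
      (use loc R supp(2) [OF w] in auto)
  \<comment> \<open>At the smallest entry \<open>a_l / sqrt n\<close> of \<open>At\<close>, the
    shift leaves \<open>(a_u - a_l) / sqrt n\<close>, and the scaling turns this into
    \<open>1 / (2 * n)\<close>.\<close>
  have A_ge: "1 / (2 * real n) \<le> A i j" if "i < n" "j < p" for i j
  proof -
    have arith: "1 / (2 * (r * r)) = e / r / (2 * e * r)" if "0 < e" "0 < r" for e r :: real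
      using that by simp
    have "1 / (2 * real n) = (a_u - a_l) / sqrt (real n) / (2 * (a_u - a_l) * sqrt (real n))"
      using arith [of "a_u - a_l" "sqrt (real n)"] a n by simp
    also have "\<dots> \<le> (At i j + (a_u - 2 * a_l) / sqrt (real n)) / (2 * (a_u - a_l) * sqrt (real n))"
    proof (rule divide_right_mono)
      have "(a_u - a_l) / sqrt (real n) = a_l / sqrt (real n) + (a_u - 2 * a_l) / sqrt (real n)"
        by (simp add: add_divide_distrib [symmetric])
      then show "(a_u - a_l) / sqrt (real n) \<le> At i j + (a_u - 2 * a_l) / sqrt (real n)"
        using At_ge [OF that] by linarith
    qed (use a in auto)
    finally show ?thesis using A_eq [OF that] by simp
  qed
  have rate: "0 < T * mat_vec n p A h i"
    if "\<And>j. j < p \<Longrightarrow> 0 \<le> h j" "(\<Sum>j<p. h j) = 1" "i < n" for h i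
  proof -
    have "0 < 1 / (2 * real n)" using n by simp
    also have "\<dots> \<le> mat_vec n p A h i"
      by (rule mat_vec_simplex_ge [OF A_ge \<open>i < n\<close> that(1,2)]) auto
    finally show ?thesis using T by simp
  qed
  have rateF: "0 < T * mat_vec n p A (F w) i" if "w \<in> W" "i < n" for w i
  proof (rule rate)
    show "\<And>j. j < p \<Longrightarrow> 0 \<le> F w j" using cls [OF \<open>w \<in> W\<close>] by (simp add: signal_class_def)
    show "(\<Sum>j<p. F w j) = 1" unfolding F_def by (rule sum_sparse_signal [OF D D0 p0])
  qed fact
  have rateg: "0 < T * mat_vec n p A g i" if "i < n" for i
  proof (rule rate)
    show "0 \<le> g j" if "j < p" for j
      using sparse_signal_eq [of p D j \<alpha> "{}", OF D0 that] by (simp add: g_def)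
    show "(\<Sum>j<p. g j) = 1" unfolding g_def by (rule sum_sparse_signal [OF D D0 p0])
  qed fact
  have "\<exists>w\<in>W. measure (poisson_law n (\<lambda>i. T * mat_vec n p A (F w) i)) (E w) < 1 / 2"
  proof (rule poisson_many_hypotheses [OF finW rateF rateg])
    show "0 < x" using x4 by simp
    show "exp (\<Sum>i<n. (T * mat_vec n p A (F w) i - T * mat_vec n p A g i)\<^sup>2 / (T * mat_vec n p A g i)) \<le> x"
      if w: "w \<in> W" for w
    proof -
      have "(\<Sum>i<n. (T * mat_vec n p A (F w) i - T * mat_vec n p A g i)\<^sup>2 / (T * mat_vec n p A g i))
          \<le> T * (1 + \<delta>) * \<alpha>\<^sup>2 * real (card (word_support k m w)) / (2 * (a_u - a_l)\<^sup>2)"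
        unfolding F_def g_def
        by (rule sparse_signal_chi_square_le [OF D D0 p0 n T a supp(1) [OF w] A_eq A_ge])
          (use rip supp(2) [OF w] in auto)
      also have "\<dots> = T * (1 + \<delta>) * real k / (2 * (a_u - a_l)\<^sup>2) * \<alpha>\<^sup>2"
        using supp(2) [OF w] by simp
      \<comment> \<open>The constant in \<open>info\<close> is chosen to leave the exponent at
        \<open>k / 4\<close> times half of \<open>ln (p / k)\<close>, hence at most
        \<open>ln x\<close>.\<close>
      also have "\<dots> \<le> T * (1 + \<delta>) * real k / (2 * (a_u - a_l)\<^sup>2)
          * ((a_u - a_l)\<^sup>2 / (4 * (1 + \<delta>)) * (ln (real p / real k) / T))"
        using T \<delta> by (intro mult_left_mono [OF info]) auto
      also have "\<dots> = real k / 4 * (ln (real p / real k) / 2)"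
      proof -
        have "T * d * c / (2 * b) * (b / (4 * d) * (l / T)) = c / 4 * (l / 2)"
          if "0 < d" "0 < b" for d b c l :: real
          using that T by (simp add: field_simps)
        from this [of "1 + \<delta>" "(a_u - a_l)\<^sup>2" "real k"] show ?thesis using \<delta> a by simp
      qed
      also have "\<dots> \<le> real k / 4 * ln (real m)"
        by (intro mult_left_mono m(3)) auto
      finally have "exp (\<Sum>i<n. (T * mat_vec n p A (F w) i - T * mat_vec n p A g i)\<^sup>2 / (T * mat_vec n p A g i))
          \<le> exp (real k / 4 * ln (real m))" by simp
      also have "\<dots> = x" using mpos by (simp add: x_def powr_def)
      finally show ?thesis .
    qed
    show "E w \<in> sets (count_vec_space n)" if "w \<in> W" for w
      unfolding E_def using estimator_event_measurable [OF f A] by measurable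
    show "real (card {w \<in> W. y \<in> E w}) \<le> x * x" if y: "y \<in> space (count_vec_space n)" for y
    proof -
      have "{w \<in> W. y \<in> E w}
          = {w \<in> {..<k} \<rightarrow>\<^sub>E {..<m}. (norm2 p (\<lambda>j. f (A, y) j - F w j))\<^sup>2 < \<alpha>\<^sup>2 * real k / 16}"
        using y by (auto simp: W_def E_def)
      also have "real (card \<dots>) \<le> 2 ^ k * real m powr (real k / 4)"
      proof (rule card_close_points_le [OF mpos])
        fix w u assume wu: "w \<in> {..<k} \<rightarrow>\<^sub>E {..<m}" "u \<in> {..<k} \<rightarrow>\<^sub>E {..<m}"
        have "\<alpha>\<^sup>2 * real (card {b. b < k \<and> w b \<noteq> u b})
            \<le> \<alpha>\<^sup>2 * real (card (word_support k m w - word_support k m u))"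
          using hamming_le_card_word_support_diff [OF wu] by (intro mult_left_mono) auto
        also have "\<dots> \<le> (\<Sum>j<p. (F w j - F u j)\<^sup>2)"
          unfolding F_def using supp(1) [of w] wu by (intro sparse_signal_separation [OF D p0]) (simp add: W_def)
        finally show "\<alpha>\<^sup>2 * real (card {b. b < k \<and> w b \<noteq> u b}) \<le> (\<Sum>j<p. (F w j - F u j)\<^sup>2)" .
      qed simp
      also have "\<dots> \<le> x * x"
        unfolding x_def [symmetric] using two_le x4 by (intro mult_right_mono) auto
      finally show ?thesis .
    qed
    show "4 * x * (x * x) < real (card W)"
    proof -
      have "4 * x * (x * x) = 4 * x ^ 3" by (simp add: power3_eq_cube)
      also have "\<dots> < x * x ^ 3" using x4 by (intro mult_strict_right_mono) auto
      also have "\<dots> = x ^ 4" by (simp add: numeral_eq_Suc)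
      finally show ?thesis by (simp only: cardW)
    qed
  qed
  then obtain w where w: "w \<in> W" and lt: "measure (poisson_law n (\<lambda>i. T * mat_vec n p A (F w) i)) (E w) < 1 / 2"
    by blast
  interpret prob_space "poisson_law n (\<lambda>i. T * mat_vec n p A (F w) i)"
    by (rule prob_space_poisson_law)
  have Ew: "E w \<in> events"
    unfolding E_def using estimator_event_measurable [OF f A] by simp
  have "{y \<in> space (count_vec_space n). \<alpha>\<^sup>2 * real k / 16 \<le> (norm2 p (\<lambda>j. f (A, y) j - F w j))\<^sup>2}
      = space (poisson_law n (\<lambda>i. T * mat_vec n p A (F w) i)) - E w"
    by (auto simp: E_def)
  then show ?thesis
    using prob_compl [OF Ew] lt cls [OF w] by (intro bexI [of _ "F w"]) auto
qed

section \<open>Choice of the constant, the sparsity level and the amplitude\<close>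

theorem theorem1:
  fixes q C_K a_l a_u \<delta> :: real
  assumes "0 < q" and "q \<le> 1" and "0 < C_K"
    and "a_l < a_u" and "0 < \<delta>" and "\<delta> < 1"
  shows "\<exists>C_L>0. \<forall>(R::real) (n::nat) (p::nat) (T::real) (K::nat)
      (D :: nat \<Rightarrow> nat \<Rightarrow> real) (At :: nat \<Rightarrow> nat \<Rightarrow> real) (A :: nat \<Rightarrow> nat \<Rightarrow> real).
    0 < R \<longrightarrow> 0 < n \<longrightarrow> 0 < p \<longrightarrow> 0 < T \<longrightarrow>
    orthonormal_mat p D \<longrightarrow> (\<forall>i<p. D i 0 = 1 / sqrt (real p)) \<longrightarrow>
    1 \<le> K \<longrightarrow> real K \<le> C_K * R * (ln (real p) / T) powr (- q / 2) \<longrightarrow>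
    max 260 (33 * real K / 2 + 1) \<le> real p \<longrightarrow>
    At \<in> rmat n p \<longrightarrow>
    (\<forall>i<n. \<forall>j<p. At i j \<in> {a_l / sqrt (real n) .. a_u / sqrt (real n)}) \<longrightarrow>
    A \<in> rmat n p \<longrightarrow>
    (\<forall>i<n. \<forall>j<p. A i j =
       (At i j + (a_u - 2 * a_l) / sqrt (real n)) / (2 * (a_u - a_l) * sqrt (real n))) \<longrightarrow>
    (\<forall>u\<in>rvec p. norm0 p u \<le> 2 * K \<longrightarrow>
       (norm2 n (mat_vec n p At (mat_vec p p D u)))\<^sup>2 \<le> (1 + \<delta>) * (norm2 p u)\<^sup>2) \<longrightarrow>
    (\<forall>f\<in>estimators n p.
       (SUP fs\<in>signal_class p q R D.
          measure (poisson_law n (\<lambda>i. T * mat_vec n p A fs i))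
            {y \<in> space (count_vec_space n).
               (norm2 p (\<lambda>j. f (A, y) j - fs j))\<^sup>2 \<ge>
               C_L * Max ((\<lambda>k. min (real k / ((real p)\<^sup>2 * (sparse_localization p (p - 1) (drop_first_col p p D) k)\<^sup>2))
                                   (real k * ln (real p / real k) / T)) ` {1..K})})
       > 1 / 2)"
proof -
  \<comment> \<open>One term for each constraint on the amplitude: 1 for localization, the second
    for the divergence, and the third, whose power \<open>q / 2\<close> is \<open>1 / C_K\<close>,
    for the class radius.\<close>
  define c where "c = min 1 (min ((a_u - a_l)\<^sup>2 / (4 * (1 + \<delta>))) (C_K powr (- 2 / q)))"
  have c: "0 < c" "c \<le> 1" "c \<le> (a_u - a_l)\<^sup>2 / (4 * (1 + \<delta>))" "c \<le> C_K powr (- 2 / q)"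
    using assms by (auto simp: c_def)
  have c_q: "C_K * c powr (q / 2) \<le> 1"
  proof -
    have "c powr (q / 2) \<le> (C_K powr (- 2 / q)) powr (q / 2)"
      using c assms by (intro powr_mono2) auto
    also have "\<dots> = inverse C_K"
      unfolding powr_powr using assms by (simp add: powr_minus)
    finally show ?thesis
      using \<open>0 < C_K\<close> by (simp add: field_simps)
  qed
  show ?thesis
  proof (intro exI [of _ "c / 16"] conjI allI impI ballI)
    show "0 < c / 16" using c by simp
    fix R :: real and n p :: nat and T :: real and K :: nat and D At A :: "nat \<Rightarrow> nat \<Rightarrow> real" and f
    assume R: "0 < R" and n: "0 < n" and p0: "0 < p" and T: "0 < T" and D: "orthonormal_mat p D"
      and D0: "\<forall>i<p. D i 0 = 1 / sqrt (real p)" and K1: "1 \<le> K"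
      and K: "real K \<le> C_K * R * (ln (real p) / T) powr (- q / 2)"
      and p: "max 260 (33 * real K / 2 + 1) \<le> real p"
      and At: "At \<in> rmat n p" "\<forall>i<n. \<forall>j<p. At i j \<in> {a_l / sqrt (real n)..a_u / sqrt (real n)}"
      and A: "A \<in> rmat n p" "\<forall>i<n. \<forall>j<p. A i j =
          (At i j + (a_u - 2 * a_l) / sqrt (real n)) / (2 * (a_u - a_l) * sqrt (real n))"
      and rip: "\<forall>u\<in>rvec p. norm0 p u \<le> 2 * K \<longrightarrow>
          (norm2 n (mat_vec n p At (mat_vec p p D u)))\<^sup>2 \<le> (1 + \<delta>) * (norm2 p u)\<^sup>2"
      and f: "f \<in> estimators n p"
    define lam where "lam = sparse_localization p (p - 1) (drop_first_col p p D)"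
    define rate where "rate = (\<lambda>k. min (real k / ((real p)\<^sup>2 * (lam k)\<^sup>2)) (real k * ln (real p / real k) / T))"
    have "Max (rate ` {1..K}) \<in> rate ` {1..K}" using K1 by (intro Max_in) auto
    then obtain k where k: "1 \<le> k" "k \<le> K" and max_eq: "Max (rate ` {1..K}) = rate k" by auto
    have kp: "33 * real k / 2 + 1 \<le> real p" and p260: "260 \<le> p" using p k by auto
    have kp1: "1 \<le> real p / real k" using kp k by (simp add: field_simps)
    \<comment> \<open>If \<open>lam k = 0\<close>, division by zero makes \<open>t\<close>, and hence \<open>rate k\<close>, vanish; no case split is needed.\<close>
    define t where "t = min (1 / ((real p)\<^sup>2 * (lam k)\<^sup>2)) (ln (real p / real k) / T)"
    \<comment> \<open>Then \<open>\<alpha>\<^sup>2 * k / 16\<close> is \<open>c / 16\<close> times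
      the maximal rate.\<close>
    define \<alpha> where "\<alpha> = sqrt (c * t)"
    have t0: "0 \<le> t" using kp1 T by (simp add: t_def)
    have \<alpha>0: "0 \<le> \<alpha>" and \<alpha>2: "\<alpha>\<^sup>2 = c * t" using c t0 by (auto simp: \<alpha>_def)
    have rate_k: "rate k = real k * t"
      unfolding rate_def t_def using k by (simp add: min_mult_distrib_left)
    have "\<exists>fs\<in>signal_class p q R D. 1 / 2 < measure (poisson_law n (\<lambda>i. T * mat_vec n p A fs i))
      {y \<in> space (count_vec_space n). \<alpha>\<^sup>2 * real k / 16 \<le> (norm2 p (\<lambda>j. f (A, y) j - fs j))\<^sup>2}"
    proof (rule sparse_minimax_lower_bound [where a_l = a_l and a_u = a_u and At = At and \<delta> = \<delta> and D = D])
      show "\<alpha> * sparse_localization p (p - 1) (drop_first_col p p D) k \<le> 1 / real p"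
      proof (rule power2_le_imp_le)
        have "(\<alpha> * lam k)\<^sup>2 = c * t * (lam k)\<^sup>2" by (simp add: power_mult_distrib \<alpha>2)
        also have "\<dots> \<le> 1 * (1 / ((real p)\<^sup>2 * (lam k)\<^sup>2)) * (lam k)\<^sup>2"
          using c t0 by (intro mult_right_mono mult_mono) (auto simp: t_def)
        \<comment> \<open>Not an equality: the left side is 0 when \<open>lam k = 0\<close>.\<close>
        also have "\<dots> \<le> (1 / real p)\<^sup>2" by (simp add: power_divide)
        finally show "(\<alpha> * sparse_localization p (p - 1) (drop_first_col p p D) k)\<^sup>2 \<le> (1 / real p)\<^sup>2"
          by (simp add: lam_def)
      qed simp
      show "real k * \<alpha> powr q \<le> R"
      proof -
        \<comment> \<open>The bound \<open>k \<le> K\<close> brings the factor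
          \<open>L powr (- q / 2)\<close>, and \<open>t \<le> L\<close> brings
          \<open>L powr (q / 2)\<close>; these cancel and leave \<open>R\<close> times at most
          1.\<close>
        define L where "L = ln (real p) / T"
        have L: "0 < L" using p260 T by (simp add: L_def)
        have "ln (real p / real k) \<le> ln (real p)"
          using k p260 by (subst ln_le_cancel_iff) (auto simp: field_simps)
        then have tL: "t \<le> L" unfolding t_def L_def using T by (intro min.coboundedI2 divide_right_mono) auto
        have "\<alpha> powr q = (c * t) powr (q / 2)"
          using c t0 by (simp add: \<alpha>_def powr_half_sqrt [symmetric] powr_powr)
        also have "\<dots> \<le> (c * L) powr (q / 2)"
          using c t0 tL assms by (intro powr_mono2) auto
        also have "\<dots> = c powr (q / 2) * L powr (q / 2)"
          using c L by (simp add: powr_mult)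
        finally have "real k * \<alpha> powr q \<le> (C_K * R * L powr (- q / 2)) * (c powr (q / 2) * L powr (q / 2))"
          using k K unfolding L_def by (intro mult_mono) auto
        also have "\<dots> = R * (C_K * c powr (q / 2))"
          using L by (simp add: powr_minus field_simps)
        also have "\<dots> \<le> R * 1" using R c_q by (intro mult_left_mono) auto
        finally show ?thesis by simp
      qed
      show "\<alpha>\<^sup>2 \<le> (a_u - a_l)\<^sup>2 / (4 * (1 + \<delta>)) * (ln (real p / real k) / T)"
        unfolding \<alpha>2 using c t0 assms by (intro mult_mono) (auto simp: t_def)
    \<comment> \<open>The isometry bound up to sparsity \<open>2 * K\<close> covers
      \<open>2 * k\<close> because \<open>k \<le> K\<close>.\<close>
    qed (use assms D D0 n T k p260 kp At A rip \<alpha>0 f in auto)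
    moreover have "\<alpha>\<^sup>2 * real k / 16 = c / 16 * Max (rate ` {1..K})"
      by (simp only: \<alpha>2 max_eq rate_k) simp
    ultimately obtain fs where fs: "fs \<in> signal_class p q R D"
      and gt: "1 / 2 < measure (poisson_law n (\<lambda>i. T * mat_vec n p A fs i))
        {y \<in> space (count_vec_space n). (norm2 p (\<lambda>j. f (A, y) j - fs j))\<^sup>2 \<ge> c / 16 * Max (rate ` {1..K})}"
      by auto
    let ?P = "\<lambda>fs. measure (poisson_law n (\<lambda>i. T * mat_vec n p A fs i))
        {y \<in> space (count_vec_space n). (norm2 p (\<lambda>j. f (A, y) j - fs j))\<^sup>2 \<ge> c / 16 * Max (rate ` {1..K})}"
    \<comment> \<open>Probabilities are at most 1, so the supremum is over a bounded set and
      dominates the value at \<open>fs\<close>, which already exceeds 1/2.\<close>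
    have "?P fs \<le> (SUP fs\<in>signal_class p q R D. ?P fs)"
      using fs prob_space.prob_le_1 [OF prob_space_poisson_law]
      by (intro cSUP_upper bdd_aboveI2 [where M = 1]) auto
    with gt show "1 / 2 < (SUP fs\<in>signal_class p q R D.
          measure (poisson_law n (\<lambda>i. T * mat_vec n p A fs i))
            {y \<in> space (count_vec_space n).
               (norm2 p (\<lambda>j. f (A, y) j - fs j))\<^sup>2 \<ge>
               c / 16 * Max ((\<lambda>k. min (real k / ((real p)\<^sup>2 * (sparse_localization p (p - 1) (drop_first_col p p D) k)\<^sup>2))
                                   (real k * ln (real p / real k) / T)) ` {1..K})})"
      unfolding rate_def lam_def by linarith
  qed
qed

end
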